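(* Let $n\ge 1$, let $m_1,\dots,m_n,M_1,\dots,M_n\in SL(2,\mathbb{C})$, and put $m_0=M_0=I_2$. Define the $(n+1)\times(n+1)$ matrix $A=(A_{i,j})_{0\le i,j\le n}$ by $$A_{i,j}=\begin{cases}\operatorname{tr}(m_iM_j^{-1}) & \text{if } i+j \text{ is even},\\ \operatorname{tr}(m_iM_j) & \text{otherwise},\end{cases}$$ and define the $n\times n$ matrices $B=(B_{i,j})_{1\le i,j\le n}$ and $C=(C_{i,j})_{1\le i,j\le n}$ by $B_{i,j}=\operatorname{tr}(m_iM_j)$ and $C_{i,j}=\operatorname{tr}(m_iM_j^{-1})$. Then $$\det A=(-1)^n\det B+\det C.$$ Further, if $n\ge 4$, then $\det A=0$, while if $n>4$, then $\det B=\det C=0$.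
   Context: $SL(2,\mathbb{C})$ is the group of complex $2\times2$ matrices of determinant $1$, $I_2$ is the $2\times 2$ identity matrix, and $\operatorname{tr}$ denotes the trace. *)

theory Defs
  imports "HOL-Analysis.Determinants" "Jordan_Normal_Form.Determinant"
begin

text \<open>
  Elements of \<open>SL(2,\<complex>)\<close> are fixed-size matrices of HOL-Analysis, with its determinant, trace and
  \<open>matrix_inv\<close>. The matrices whose size depends on \<open>n\<close> are the explicit-size matrices of \<open>Jordan_Normal_Form\<close>,
  whose indices start at 0. Hence \<open>A\<close> is indexed as on paper, while position \<open>(i, j)\<close> of
  \<open>B\<close> and \<open>C\<close> holds the entry with index \<open>(i + 1, j + 1)\<close>.
\<close>

definition SL2C :: "(complex^2^2) set" where
  "SL2C = {X. Determinants.det X = 1}"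

definition matA :: "nat \<Rightarrow> (nat \<Rightarrow> complex^2^2) \<Rightarrow> (nat \<Rightarrow> complex^2^2) \<Rightarrow> complex Matrix.mat" where
  "matA n m M = Matrix.mat (n + 1) (n + 1) (\<lambda>(i, j).
     if even (i + j) then Determinants.trace (m i ** matrix_inv (M j))
     else Determinants.trace (m i ** M j))"

definition matB :: "nat \<Rightarrow> (nat \<Rightarrow> complex^2^2) \<Rightarrow> (nat \<Rightarrow> complex^2^2) \<Rightarrow> complex Matrix.mat" where
  "matB n m M = Matrix.mat n n (\<lambda>(i, j). Determinants.trace (m (i + 1) ** M (j + 1)))"

definition matC :: "nat \<Rightarrow> (nat \<Rightarrow> complex^2^2) \<Rightarrow> (nat \<Rightarrow> complex^2^2) \<Rightarrow> complex Matrix.mat" where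
  "matC n m M = Matrix.mat n n (\<lambda>(i, j). Determinants.trace (m (i + 1) ** matrix_inv (M (j + 1))))"

end

theory Submission
  imports Defs
begin

text \<open>
  Put \<open>t i = tr (m i)\<close> and \<open>s j = tr (M j)\<close> for \<open>i, j \<ge> 1\<close>. The Cayley-Hamilton identity
  \<open>M + M\<inverse> = tr M \<cdot> I\<close> in \<open>SL(2,\<complex>)\<close> gives \<open>B = t s\<^sup>T - C\<close>, so the whole problem
  concerns the pencil \<open>C - x t s\<^sup>T\<close>: it is \<open>C\<close> at \<open>x = 0\<close>, it is \<open>-B\<close> at \<open>x = 1\<close>, and the midpoint
  \<open>E = C - t s\<^sup>T / 2\<close> turns out to control \<open>A\<close>.

  Row and column \<open>0\<close> of \<open>A\<close> are \<open>(2, s)\<close> and \<open>(2, t)\<close>, because the index \<open>0\<close> belongs to the identity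
  matrix and inversion preserves the trace. Eliminating them with the pivot \<open>2\<close> subtracts
  \<open>t i * s j / 2\<close> from each remaining entry. Where \<open>i + j\<close> is even this yields \<open>C - t s\<^sup>T / 2 = E\<close>, and
  where it is odd \<open>B - t s\<^sup>T / 2 = -E\<close>. The checkerboard of signs does not affect the determinant
  (\<open>det_sign_conjugate\<close>), so \<open>det A = 2 det E\<close>. The determinant of \<open>C - x t s\<^sup>T\<close> is affine in \<open>x\<close>, since only a matrix
  of rank one varies, so twice its value at the midpoint is the sum of the values at the two ends
  (\<open>det_rank_one_midpoint\<close>): \<open>2 det E = det C + det (-B)\<close>.

  The vanishing statements are bounds on ranks (\<open>det_eq_0_if_low_rank\<close>). As bilinear expressions in the four
  entries of \<open>m i\<close> and of \<open>M j\<close>, the entries of \<open>B\<close> and \<open>C\<close> have rank at most \<open>4\<close>. Those of \<open>E\<close> depend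
  only on the traceless parts of \<open>m i\<close> and \<open>M j\<close>, which lie in a space of dimension \<open>3\<close>.
\<close>

\<comment> \<open>The symbol is kept for the components of fixed-size vectors; with both readings, terms with
  many components have exponentially many parses.\<close>
no_notation vec_index (infixl "$" 100)

text \<open>
  A factorization through dimension \<open>k < n\<close> becomes a product of square matrices after padding
  with zeros, and the padded right factor has a zero row.
\<close>
lemma det_eq_0_if_low_rank:
  fixes f g :: "nat \<Rightarrow> nat \<Rightarrow> 'a :: comm_ring_1"
  assumes "k < n"
  shows "Determinant.det (Matrix.mat n n (\<lambda>(i, j). \<Sum>l<k. f i l * g l j)) = 0"
proof -
  define P where "P = Matrix.mat n n (\<lambda>(i, l). if l < k then f i l else 0)"
  define Q where "Q = Matrix.mat n n (\<lambda>(l, j). if l < k then g l j else 0)"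
  have "(\<Sum>l<k. f i l * g l j) = (\<Sum>l<n. (if l < k then f i l else 0) * (if l < k then g l j else 0))"
    for i j
    using assms by (intro sum.mono_neutral_cong_left) auto
  then have "Matrix.mat n n (\<lambda>(i, j). \<Sum>l<k. f i l * g l j) = P * Q"
    by (intro eq_matI) (auto simp: P_def Q_def scalar_prod_def atLeast0LessThan)
  moreover have "Determinant.det Q = (\<Sum>j<n. Q $$ (k, j) * cofactor Q k j)"
    using assms by (intro laplace_expansion_row) (auto simp: Q_def)
  then have "Determinant.det Q = 0"
    using assms by (simp add: Q_def)
  ultimately show ?thesis
    using det_mult[of P n Q] by (simp add: P_def Q_def)
qed

definition bordered :: "nat \<Rightarrow> 'a \<Rightarrow> (nat \<Rightarrow> 'a) \<Rightarrow> (nat \<Rightarrow> 'a) \<Rightarrow> (nat \<Rightarrow> nat \<Rightarrow> 'a) \<Rightarrow> 'a Matrix.mat"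
  where "bordered n a u v f = Matrix.mat (Suc n) (Suc n)
    (\<lambda>(i, j). case i of 0 \<Rightarrow> (case j of 0 \<Rightarrow> a | Suc j' \<Rightarrow> v j')
                      | Suc i' \<Rightarrow> (case j of 0 \<Rightarrow> u i' | Suc j' \<Rightarrow> f i' j'))"

lemma bordered_carrier [simp]: "bordered n a u v f \<in> carrier_mat (Suc n) (Suc n)"
  by (simp add: bordered_def)

text \<open>
  The remainder after splitting off the corner does not contain \<open>a\<close>. This is what makes two
  corners over the same border comparable; with \<open>v = 0\<close> the remainder disappears.
\<close>
lemma det_bordered_expand:
  fixes a :: "'a :: comm_ring_1"
  shows "Determinant.det (bordered n a u v f) =
    a * Determinant.det (Matrix.mat n n (\<lambda>(i, j). f i j))
      + (\<Sum>j<n. v j * cofactor (bordered n 0 u v f) 0 (Suc j))"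
proof -
  have corner: "mat_delete (bordered n a u v f) 0 0 = Matrix.mat n n (\<lambda>(i, j). f i j)"
    by (intro eq_matI) (auto simp: mat_delete_def bordered_def)
  have rest: "cofactor (bordered n a u v f) 0 j = cofactor (bordered n 0 u v f) 0 j" for j
    unfolding cofactor_def
    by (rule arg_cong[where f = "\<lambda>X. _ * Determinant.det X"])
      (auto simp: mat_delete_def bordered_def intro!: eq_matI)
  have "Determinant.det (bordered n a u v f) =
      (\<Sum>j<Suc n. bordered n a u v f $$ (0, j) * cofactor (bordered n a u v f) 0 j)"
    by (intro laplace_expansion_row) auto
  also have "\<dots> = a * cofactor (bordered n a u v f) 0 0
      + (\<Sum>j<n. v j * cofactor (bordered n a u v f) 0 (Suc j))"
    by (simp add: sum.lessThan_Suc_shift bordered_def del: sum.lessThan_Suc)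
  also have "cofactor (bordered n a u v f) 0 0 = Determinant.det (Matrix.mat n n (\<lambda>(i, j). f i j))"
    by (simp add: cofactor_def corner)
  finally show ?thesis by (simp add: rest)
qed

text \<open>
  Column operations with the pivot \<open>a\<close> clear the first row, that is, the bordered matrix is a
  lower block triangular matrix times a unipotent upper triangular one.
\<close>
lemma det_bordered_schur:
  fixes a :: "'a :: field"
  assumes "a \<noteq> 0"
  shows "Determinant.det (bordered n a u v f) =
    a * Determinant.det (Matrix.mat n n (\<lambda>(i, j). f i j - u i * v j / a))"
proof -
  define L where "L = bordered n a u (\<lambda>_. 0) (\<lambda>i j. f i j - u i * v j / a)"
  define U where "U = bordered n 1 (\<lambda>_. 0) (\<lambda>j. v j / a) (\<lambda>i j. if i = j then 1 else 0)"
  have "bordered n a u v f = L * U"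
    using assms
    by (intro eq_matI)
      (auto simp: L_def U_def bordered_def scalar_prod_def sum.atLeast0_lessThan_Suc_shift
            if_distrib sum.delta cong: if_cong split: nat.splits simp del: sum.op_ivl_Suc)
  moreover have "Determinant.det U = 1"
  proof -
    have "upper_triangular U"
      by (auto simp: upper_triangular_def U_def bordered_def split: nat.splits)
    moreover have "diag_mat U = replicate (Suc n) 1"
      by (intro nth_equalityI) (auto simp: diag_mat_def U_def bordered_def split: nat.splits simp del: upt_Suc replicate_Suc)
    ultimately show ?thesis
      by (subst det_upper_triangular[of U "Suc n"]) (auto simp: U_def)
  qed
  ultimately show ?thesis
    using det_mult[of L "Suc n" U] det_bordered_expand[of n a u "\<lambda>_. 0" "\<lambda>i j. f i j - u i * v j / a"]
    by (simp add: L_def U_def)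
qed

text \<open>
  For \<open>a \<noteq> 0\<close> the Schur complement of the corner \<open>a\<close> turns \<open>a det (f - u v\<^sup>T / a)\<close> into a bordered
  determinant, which is \<open>a det f\<close> plus a constant. Comparing the corners \<open>2\<close> and \<open>1\<close> eliminates
  that constant.
\<close>
lemma det_rank_one_midpoint:
  fixes f :: "nat \<Rightarrow> nat \<Rightarrow> 'a :: field_char_0"
  shows "2 * Determinant.det (Matrix.mat n n (\<lambda>(i, j). f i j - u i * v j / 2)) =
    Determinant.det (Matrix.mat n n (\<lambda>(i, j). f i j)) +
    Determinant.det (Matrix.mat n n (\<lambda>(i, j). f i j - u i * v j))"
proof -
  define r where "r = (\<Sum>j<n. v j * cofactor (bordered n 0 u v f) 0 (Suc j))"
  have "2 * Determinant.det (Matrix.mat n n (\<lambda>(i, j). f i j - u i * v j / 2)) =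
      2 * Determinant.det (Matrix.mat n n (\<lambda>(i, j). f i j)) + r"
    using det_bordered_schur[of 2 n u v f] det_bordered_expand[of n 2 u v f] by (simp add: r_def)
  moreover have "Determinant.det (Matrix.mat n n (\<lambda>(i, j). f i j - u i * v j)) =
      Determinant.det (Matrix.mat n n (\<lambda>(i, j). f i j)) + r"
    using det_bordered_schur[of 1 n u v f] det_bordered_expand[of n 1 u v f] by (simp add: r_def)
  ultimately show ?thesis by simp
qed

text \<open>
  The signs come from conjugation with the diagonal matrix of the \<open>(-1) ^ i\<close>: in each term of the
  Leibniz formula every sign occurs once for its row and once for its column.
\<close>
lemma det_sign_conjugate:
  fixes f :: "nat \<Rightarrow> nat \<Rightarrow> 'a :: comm_ring_1"
  shows "Determinant.det (Matrix.mat n n (\<lambda>(i, j). (-1) ^ (i + j) * f i j)) =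
    Determinant.det (Matrix.mat n n (\<lambda>(i, j). f i j))"
proof -
  have "(\<Prod>i = 0..<n. (-1) ^ (i + p i) * f i (p i)) = (\<Prod>i = 0..<n. f i (p i))"
    if p: "p permutes {0..<n}" for p
  proof -
    have "(\<Prod>i = 0..<n. (-1 :: 'a) ^ p i) = (\<Prod>i = 0..<n. (-1) ^ i)"
      using prod.permute[OF p, of "\<lambda>i. (-1 :: 'a) ^ i"] by (simp add: o_def)
    then have "(\<Prod>i = 0..<n. (-1 :: 'a) ^ (i + p i)) = (\<Prod>i = 0..<n. (-1) ^ i * (-1) ^ i)"
      by (simp only: power_add prod.distrib)
    also have "\<dots> = 1"
      by simp
    finally show ?thesis by (simp add: prod.distrib)
  qed
  moreover have "(\<Prod>i = 0..<n. Matrix.mat n n (\<lambda>(i, j). h i j) $$ (i, p i)) = (\<Prod>i = 0..<n. h i (p i))"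
    if "p permutes {0..<n}" for p and h :: "nat \<Rightarrow> nat \<Rightarrow> 'a"
    using permutes_in_image[OF that] by (intro prod.cong) auto
  ultimately show ?thesis
    by (simp add: Determinant.det_def)
qed

lemma trace_mult_2:
  fixes X Y :: "'a :: comm_ring_1 ^ 2 ^ 2"
  shows "trace (X ** Y) = X$1$1 * Y$1$1 + X$1$2 * Y$2$1 + X$2$1 * Y$1$2 + X$2$2 * Y$2$2"
  by (simp add: trace_def matrix_matrix_mult_def sum_2)

lemma trace_mult_inv_SL2C:
  assumes "Y \<in> SL2C"
  shows "trace (X ** matrix_inv Y) = X$1$1 * Y$2$2 - X$1$2 * Y$2$1 - X$2$1 * Y$1$2 + X$2$2 * Y$1$1"
proof -
  \<comment> \<open>the adjugate of \<open>Y\<close>\<close>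
  define Z :: "complex^2^2" where "Z = vector [vector [Y$2$2, - Y$1$2], vector [- Y$2$1, Y$1$1]]"
  have d: "Y$1$1 * Y$2$2 - Y$1$2 * Y$2$1 = 1"
    using assms by (simp add: SL2C_def det_2)
  then have Z: "Y ** Z = Finite_Cartesian_Product.mat 1 \<and> Z ** Y = Finite_Cartesian_Product.mat 1"
    unfolding Finite_Cartesian_Product.vec_eq_iff
    by (simp_all add: Z_def matrix_matrix_mult_def sum_2 forall_2 Finite_Cartesian_Product.mat_def algebra_simps)
  then have "matrix_inv Y ** Y = Finite_Cartesian_Product.mat 1"
    unfolding matrix_inv_def by (rule someI2) simp
  with Z have "matrix_inv Y = Z"
    by (metis matrix_mul_assoc matrix_mul_lid matrix_mul_rid)
  then show ?thesis
    by (simp add: trace_mult_2 Z_def)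
qed

theorem mainTheorem1:
  fixes n :: nat and m M :: "nat \<Rightarrow> complex^2^2"
  assumes "n \<ge> 1"
    and "\<forall>i\<in>{1..n}. m i \<in> SL2C"
    and "\<forall>i\<in>{1..n}. M i \<in> SL2C"
    and "m 0 = Finite_Cartesian_Product.mat 1"
    and "M 0 = Finite_Cartesian_Product.mat 1"
  shows "Determinant.det (matA n m M)
           = (-1) ^ n * Determinant.det (matB n m M) + Determinant.det (matC n m M)
       \<and> (n \<ge> 4 \<longrightarrow> Determinant.det (matA n m M) = 0)
       \<and> (n > 4 \<longrightarrow> Determinant.det (matB n m M) = 0 \<and> Determinant.det (matC n m M) = 0)"
proof -
  \<comment> \<open>The shift matches the indexing of \<open>B\<close> and \<open>C\<close>, and of the part of a bordered matrix inside its
    border. It preserves the parity of \<open>i + j\<close>.\<close>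
  define x where "x i = m (Suc i)" for i
  define y where "y j = M (Suc j)" for j
  define t where "t i = x i$1$1 + x i$2$2" for i
  define s where "s j = y j$1$1 + y j$2$2" for j
  define b where "b i j = trace (x i ** y j)" for i j
  define c where "c i j = x i$1$1 * y j$2$2 - x i$1$2 * y j$2$1 - x i$2$1 * y j$1$2 + x i$2$2 * y j$1$1" for i j
  define e where "e i j = c i j - t i * s j / 2" for i j
  have M_SL2C: "M j \<in> SL2C" if "j \<le> n" for j
    using assms(3,5) that by (cases j) (auto simp: SL2C_def)
  have inv: "trace (X ** matrix_inv (M j)) =
      X$1$1 * M j$2$2 - X$1$2 * M j$2$1 - X$2$1 * M j$1$2 + X$2$2 * M j$1$1" if "j \<le> n" for X j
    using M_SL2C[OF that] by (rule trace_mult_inv_SL2C)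
  have m0: "m 0$1$1 = 1" "m 0$1$2 = 0" "m 0$2$1 = 0" "m 0$2$2 = 1"
    and M0: "M 0$1$1 = 1" "M 0$1$2 = 0" "M 0$2$1 = 0" "M 0$2$2 = 1"
    by (simp_all add: assms(4,5) Finite_Cartesian_Product.mat_def)
  have A: "matA n m M = bordered n 2 t s (\<lambda>i j. if even (i + j) then c i j else b i j)"
    by (intro eq_matI)
      (auto simp: matA_def bordered_def x_def y_def c_def b_def t_def s_def inv
         trace_mult_2[of _ "M j" for j] m0 M0 split: nat.splits)
  have B: "matB n m M = Matrix.mat n n (\<lambda>(i, j). b i j)"
    by (auto simp: matB_def b_def x_def y_def)
  have C: "matC n m M = Matrix.mat n n (\<lambda>(i, j). c i j)"
    by (intro eq_matI) (auto simp: matC_def c_def x_def y_def inv)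
  have cayley_hamilton: "b i j = t i * s j - c i j" for i j
    by (simp add: b_def c_def t_def s_def trace_mult_2 algebra_simps)
  have negB: "Matrix.mat n n (\<lambda>(i, j). c i j - t i * s j) = (-1) \<cdot>\<^sub>m matB n m M"
    unfolding B by (intro eq_matI) (auto simp: cayley_hamilton)
  have "(if even (i + j) then c i j else b i j) - t i * s j / 2 = (-1) ^ (i + j) * e i j" for i j
    by (auto simp: cayley_hamilton e_def field_simps)
  then have detA: "Determinant.det (matA n m M) = 2 * Determinant.det (Matrix.mat n n (\<lambda>(i, j). e i j))"
    by (simp add: A det_bordered_schur det_sign_conjugate)
  have "Determinant.det (matA n m M) = (-1) ^ n * Determinant.det (matB n m M) + Determinant.det (matC n m M)"
    using det_rank_one_midpoint[of n c t s]
    by (simp add: detA e_def negB C B)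
  moreover have "Determinant.det (matA n m M) = 0" if "n \<ge> 4"
  proof -
    \<comment> \<open>The coordinates \<open>X$1$1 - X$2$2\<close>, \<open>X$1$2\<close>, \<open>X$2$1\<close> describe the traceless part of \<open>X\<close>.\<close>
    define f where "f i = (!) [- (x i$1$1 - x i$2$2) / 2, - x i$1$2, - x i$2$1]" for i
    define g where "g l j = [y j$1$1 - y j$2$2, y j$2$1, y j$1$2] ! l" for l j
    have "e = (\<lambda>i j. \<Sum>l<3. f i l * g l j)"
      by (intro ext) (simp add: e_def c_def t_def s_def f_def g_def eval_nat_numeral field_simps)
    then show ?thesis
      using det_eq_0_if_low_rank[of 3 n f g] that by (simp add: detA)
  qed
  moreover have "Determinant.det (matB n m M) = 0 \<and> Determinant.det (matC n m M) = 0" if "n > 4"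
  proof -
    define f where "f i = (!) [x i$1$1, x i$1$2, x i$2$1, x i$2$2]" for i
    define g where "g l j = [y j$1$1, y j$2$1, y j$1$2, y j$2$2] ! l" for l j
    define h where "h l j = [y j$2$2, - y j$2$1, - y j$1$2, y j$1$1] ! l" for l j
    have "b = (\<lambda>i j. \<Sum>l<4. f i l * g l j)" "c = (\<lambda>i j. \<Sum>l<4. f i l * h l j)"
      by (intro ext; simp add: b_def c_def f_def g_def h_def trace_mult_2 eval_nat_numeral)+
    then show ?thesis
      using det_eq_0_if_low_rank[of 4 n f g] det_eq_0_if_low_rank[of 4 n f h] that by (simp add: B C)
  qed
  ultimately show ?thesis by blast
qed

end
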